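(* The multiplier of the Hahn sequence space $h$ is $h$ itself, i.e. $\mathscr M(h)=h$.
   Context: All sequences are complex and indexed by $\mathbb N_0=\{0,1,2,\dots\}$. The Hahn space is $h=\{x\in\mathbb C^{\mathbb N_0}:\sum_{n=0}^\infty (n+1)|x_n-x_{n+1}|<\infty,\ \lim_n x_n=0\}$. The convolution is $(a*x)_n=\sum_{k=0}^n a_{n-k}x_k$. The multiplier of a sequence space $X$ is $\mathscr M(X)=\{a\in\mathbb C^{\mathbb N_0}: a*x\in X\text{ for all }x\in X\}$. *)

theory Defs
  imports Complex_Main
begin

definition hahn_space :: "(nat \<Rightarrow> complex) set" where
  "hahn_space = {x. summable (\<lambda>n. real (n + 1) * cmod (x n - x (n + 1))) \<and> x \<longlonglongrightarrow> 0}"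

definition convolution :: "(nat \<Rightarrow> complex) \<Rightarrow> (nat \<Rightarrow> complex) \<Rightarrow> nat \<Rightarrow> complex" where
  "convolution a x n = (\<Sum>k\<le>n. a (n - k) * x k)"

definition multiplier :: "(nat \<Rightarrow> complex) set \<Rightarrow> (nat \<Rightarrow> complex) set" where
  "multiplier X = {a. \<forall>x\<in>X. convolution a x \<in> X}"

end

theory Submission
  imports Defs
begin

text \<open>
  Convolving with the unit sequence shows that every multiplier lies in the Hahn space.
  Conversely, summation by parts embeds the Hahn space in \<open>\<ell>\<^sup>1\<close>, and the product rule
  applied to \<open>(1 - z) A(z) X(z)\<close>, where \<open>A\<close> and \<open>X\<close> are the generating functions of \<open>a\<close> and \<open>x\<close>,
  writes the weighted differences of \<open>a * x\<close> as a combination of convolutions of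
  \<open>\<ell>\<^sup>1\<close>-sequences.
\<close>

text \<open>Up to sign, these are the coefficients of the derivative of (1 - z) X(z), where X is the
  generating function of \<open>x\<close>.\<close>

definition weighted_diff :: "(nat \<Rightarrow> complex) \<Rightarrow> nat \<Rightarrow> complex" where
  "weighted_diff x n = of_nat (n + 1) * (x n - x (n + 1))"

lemma norm_weighted_diff:
  "cmod (weighted_diff x n) = real (n + 1) * cmod (x n - x (n + 1))"
  unfolding weighted_diff_def norm_mult norm_of_nat ..

lemma hahn_space_iff:
  "x \<in> hahn_space \<longleftrightarrow> summable (\<lambda>n. cmod (weighted_diff x n)) \<and> x \<longlonglongrightarrow> 0"
  unfolding hahn_space_def norm_weighted_diff by simp

text \<open>Controls the boundary term in the summation by parts below. The difference
  \<open>x N - x M\<close> telescopes, and \<open>x M\<close> disappears as \<open>M\<close> tends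
  to infinity.\<close>

lemma hahn_space_weighted_bound:
  assumes "x \<in> hahn_space"
  shows "real N * cmod (x N) \<le> (\<Sum>n. cmod (weighted_diff x n))"
proof -
  let ?S = "\<Sum>n. cmod (weighted_diff x n)"
  have sm: "summable (\<lambda>n. cmod (weighted_diff x n))" and lim: "x \<longlonglongrightarrow> 0"
    using assms by (auto simp: hahn_space_iff)
  have bound: "real N * cmod (x N) \<le> real N * cmod (x M) + ?S" if "N \<le> M" for M
  proof -
    have "x N - x M = (\<Sum>k=N..<M. x k - x (Suc k))"
      using sum_Suc_diff'[OF that, of x]
      by (simp add: sum_subtractf algebra_simps)
    then have "real N * cmod (x N - x M) \<le> real N * (\<Sum>k=N..<M. cmod (x k - x (Suc k)))"
      by (metis mult_left_mono norm_sum of_nat_0_le_iff)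
    \<comment> \<open>Every index satisfies \<open>N \<le> k\<close>, so the constant weight
      \<open>N\<close> is at most \<open>k + 1\<close>.\<close>
    also have "\<dots> \<le> (\<Sum>k=N..<M. cmod (weighted_diff x k))"
      unfolding sum_distrib_left norm_weighted_diff
      by (intro sum_mono) (auto intro!: mult_right_mono)
    also have "\<dots> \<le> ?S"
      by (intro sum_le_suminf sm) auto
    finally have "real N * cmod (x N - x M) \<le> ?S" .
    moreover have "real N * cmod (x N) \<le> real N * (cmod (x M) + cmod (x N - x M))"
      by (intro mult_left_mono) (auto intro: norm_triangle_sub)
    ultimately show ?thesis
      by (simp add: distrib_left)
  qed
  have "(\<lambda>M. real N * cmod (x M) + ?S) \<longlonglongrightarrow> real N * 0 + ?S"
    using lim by (intro tendsto_intros) (simp add: tendsto_norm_zero)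
  then have "real N * cmod (x N) \<le> real N * 0 + ?S"
    by (rule LIMSEQ_le_const) (use bound in blast)
  then show ?thesis by simp
qed

text \<open>Summation by parts applied to the moduli: the boundary term and the remaining sum are
  each at most \<open>?S\<close>, so all partial sums are bounded by \<open>?S + ?S\<close>.\<close>

lemma summable_norm_hahn_space:
  assumes "x \<in> hahn_space"
  shows "summable (\<lambda>n. cmod (x n))"
proof (rule summableI_nonneg_bounded)
  let ?S = "\<Sum>n. cmod (weighted_diff x n)"
  fix N
  have sm: "summable (\<lambda>n. cmod (weighted_diff x n))"
    using assms by (simp add: hahn_space_iff)
  have "(\<Sum>n<N. cmod (x n))
      = real N * cmod (x N) + (\<Sum>n<N. real (n + 1) * (cmod (x n) - cmod (x (n + 1))))"
    by (induction N) (simp_all add: algebra_simps)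
  also have "(\<Sum>n<N. real (n + 1) * (cmod (x n) - cmod (x (n + 1))))
      \<le> (\<Sum>n<N. cmod (weighted_diff x n))"
    unfolding norm_weighted_diff
    by (intro sum_mono mult_left_mono norm_triangle_ineq2) simp
  also have "\<dots> \<le> ?S"
    by (intro sum_le_suminf sm) auto
  finally show "(\<Sum>n<N. cmod (x n)) \<le> ?S + ?S"
    using hahn_space_weighted_bound[OF assms, of N] by linarith
qed simp

lemma summable_norm_convolution:
  assumes "summable (\<lambda>n. cmod (a n))" "summable (\<lambda>n. cmod (x n))"
  shows "summable (\<lambda>n. cmod (convolution a x n))"
proof (rule summable_comparison_test')
  show "summable (\<lambda>n. \<Sum>k\<le>n. cmod (x k) * cmod (a (n - k)))"
    using assms by (intro summable_Cauchy_product) auto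
  show "norm (cmod (convolution a x n)) \<le> (\<Sum>k\<le>n. cmod (x k) * cmod (a (n - k)))" for n
    unfolding convolution_def
    by (auto intro!: order.trans[OF norm_sum] simp: norm_mult mult.commute)
qed

text \<open>Differentiating (1 - z) A X gives ((1 - z) A)' X + (1 - z) A X', and (1 - z) X' = ((1 -
  z) X)' + X. The last summand produces the correction \<open>- convolution a x n\<close>.\<close>

lemma weighted_diff_convolution:
  "weighted_diff (convolution a x) n =
     convolution (weighted_diff a) x n + convolution a (weighted_diff x) n - convolution a x n"
proof -
  let ?t = "\<lambda>k. a (Suc n - k) * x k"
  \<comment> \<open>The second sum may run up to \<open>Suc n\<close> because its last term has
    weight 0.\<close>
  have left: "convolution (weighted_diff a) x n =
      (\<Sum>k\<le>n. of_nat (Suc n - k) * (a (n - k) * x k)) - (\<Sum>k\<le>Suc n. of_nat (Suc n - k) * ?t k)"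
    by (simp add: convolution_def weighted_diff_def Suc_diff_le sum_subtractf[symmetric] algebra_simps)
  \<comment> \<open>The term at \<open>k = 0\<close> has weight 0, so the index can be
    shifted.\<close>
  have "(\<Sum>k\<le>Suc n. of_nat k * ?t k) = (\<Sum>k\<le>n. of_nat (Suc k) * (a (n - k) * x (Suc k)))"
    by (subst sum.atMost_Suc_shift) simp
  then have right: "convolution a (weighted_diff x) n =
      (\<Sum>k\<le>n. of_nat (Suc k) * (a (n - k) * x k)) - (\<Sum>k\<le>Suc n. of_nat k * ?t k)"
    by (simp add: convolution_def weighted_diff_def sum_subtractf[symmetric] algebra_simps)
  \<comment> \<open>The weights \<open>Suc n - k\<close> and \<open>Suc k\<close> add up to
    \<open>n + 2\<close>; in \<open>high\<close> they add up to only \<open>n + 1\<close>.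
    Subtracting \<open>convolution a x n\<close> removes the surplus.\<close>
  have low: "(\<Sum>k\<le>n. of_nat (Suc n - k) * (a (n - k) * x k))
      + (\<Sum>k\<le>n. of_nat (Suc k) * (a (n - k) * x k)) = of_nat (n + 2) * convolution a x n"
    unfolding convolution_def sum.distrib[symmetric] sum_distrib_left distrib_right[symmetric]
      of_nat_add[symmetric]
    by (intro sum.cong refl arg_cong2[where f = "(*)"] arg_cong[where f = of_nat]) auto
  have high: "(\<Sum>k\<le>Suc n. of_nat (Suc n - k) * ?t k) + (\<Sum>k\<le>Suc n. of_nat k * ?t k)
      = of_nat (n + 1) * convolution a x (n + 1)"
    unfolding convolution_def sum.distrib[symmetric] sum_distrib_left distrib_right[symmetric]
      of_nat_add[symmetric] Suc_eq_plus1[symmetric]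
    by (intro sum.cong refl arg_cong2[where f = "(*)"] arg_cong[where f = of_nat]) auto
  have "convolution (weighted_diff a) x n + convolution a (weighted_diff x) n
      = of_nat (n + 2) * convolution a x n - of_nat (n + 1) * convolution a x (n + 1)"
    unfolding left right low[symmetric] high[symmetric] by (rule add_diff_add[symmetric])
  then show ?thesis
    by (simp add: weighted_diff_def algebra_simps)
qed

lemma convolution_hahn_space:
  assumes "a \<in> hahn_space" "x \<in> hahn_space"
  shows "convolution a x \<in> hahn_space"
proof -
  have a: "summable (\<lambda>n. cmod (a n))" "summable (\<lambda>n. cmod (weighted_diff a n))"
    and x: "summable (\<lambda>n. cmod (x n))" "summable (\<lambda>n. cmod (weighted_diff x n))"
    using assms by (auto simp: summable_norm_hahn_space hahn_space_iff)
  note conv = summable_norm_convolution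
  have ax: "summable (\<lambda>n. cmod (convolution a x n))"
    by (rule conv[OF a(1) x(1)])
  \<comment> \<open>All three are convolutions of absolutely summable sequences, so the product rule
    gives a summable majorant.\<close>
  have "summable (\<lambda>n. cmod (convolution (weighted_diff a) x n)
      + cmod (convolution a (weighted_diff x) n) + cmod (convolution a x n))"
    by (intro summable_add conv a x)
  then have "summable (\<lambda>n. cmod (weighted_diff (convolution a x) n))"
  proof (rule summable_comparison_test')
    show "norm (cmod (weighted_diff (convolution a x) n))
      \<le> cmod (convolution (weighted_diff a) x n)
        + cmod (convolution a (weighted_diff x) n) + cmod (convolution a x n)" for n
      unfolding weighted_diff_convolution real_norm_def abs_norm_cancel
      by (meson add_right_mono norm_triangle_ineq norm_triangle_ineq4 order.trans)
  qed
  moreover have "convolution a x \<longlonglongrightarrow> 0"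
    using summable_LIMSEQ_zero[OF ax] by (simp add: tendsto_norm_zero_iff)
  ultimately show ?thesis
    by (simp add: hahn_space_iff)
qed

definition unit_seq :: "nat \<Rightarrow> complex" where
  "unit_seq n = (if n = 0 then 1 else 0)"

lemma unit_seq_hahn_space: "unit_seq \<in> hahn_space"
proof -
  have "summable (\<lambda>n. cmod (weighted_diff unit_seq n))"
    \<comment> \<open>Only the difference between indices 0 and 1 is nonzero.\<close>
    by (rule summable_finite[of "{0}"]) (auto simp: weighted_diff_def unit_seq_def)
  moreover have "unit_seq \<longlonglongrightarrow> 0"
    by (rule tendsto_eventually)
      (auto simp: unit_seq_def eventually_sequentially intro!: exI[of _ 1])
  ultimately show ?thesis
    by (simp add: hahn_space_iff)
qed

lemma convolution_unit_seq: "convolution a unit_seq = a"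
  by (rule ext) (simp add: convolution_def unit_seq_def if_distrib sum.delta cong: if_cong)

theorem theorem5p4:
  shows "multiplier hahn_space = hahn_space"
proof
  show "multiplier hahn_space \<subseteq> hahn_space"
    unfolding multiplier_def using unit_seq_hahn_space convolution_unit_seq by force
  show "hahn_space \<subseteq> multiplier hahn_space"
    unfolding multiplier_def using convolution_hahn_space by blast
qed

end
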